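(* Let $G=(V,E)$ be a locally finite, connected, simple, undirected graph. Fix $\kappa\in\mathbb{R}$ and two integers $d,\tau\ge 0$. Suppose that $G$ satisfies $\mathrm{CD}(\kappa,\infty)$, that every vertex of $G$ has exactly $d$ neighbors, and that any two adjacent vertices of $G$ have exactly $\tau$ common neighbors. Then: 1. $2\kappa\le 4+\tau$; 2. $\mathrm{CD}(\kappa,n)$ holds for $n:=4d/(4+\tau-2\kappa)$; 3. $\mathrm{CD}(\kappa,n')$ fails for any $n'<n$.
   Context: For a locally finite graph $G=(V,E)$, write $N_x=\{y\in V:\{x,y\}\in E\}$ for the set of neighbors of $x$. The Laplacian acts on $f\in\mathbb{R}^V$ by $\Delta f(x)=\sum_{y\in N_x}(f(y)-f(x))$. For $f,g\in\mathbb{R}^V$, set $\Gamma_0(f,g)=fg$ and, for $k\ge 1$, $$\Gamma_k(f,g)=\tfrac12\left(\Delta\Gamma_{k-1}(f,g)-\Gamma_{k-1}(f,\Delta g)-\Gamma_{k-1}(g,\Delta f)\right).$$ For $\kappa\in\mathbb{R}$ and $n\in(0,\infty]$, $G$ satisfies $\mathrm{CD}(\kappa,n)$ if for all $f\in\mathbb{R}^V$ and all $x\in V$, $$\Gamma_2(f,f)(x)\ge \kappa\,\Gamma_1(f,f)(x)+\frac{(\Delta f(x))^2}{n},$$ where the last term is $0$ when $n=\infty$. When $2\kappa=4+\tau$, the quantity $4d/(4+\tau-2\kappa)$ is read as $\infty$.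
   Formalization: The degree d is assumed to be at least 1: for d = 0 the graph is a single vertex, CD(κ,n) holds for all κ and n, and the claims are false or n = 0 is outside (0,∞]. *)

theory Defs
  imports Complex_Main "HOL-Library.Extended_Real"
begin

definition nbrs :: "'a set \<Rightarrow> 'a set set \<Rightarrow> 'a \<Rightarrow> 'a set" where
  "nbrs V E x = {y \<in> V. {x, y} \<in> E}"

text \<open>Requiring edges to have exactly two elements excludes loops.\<close>
definition simple_graph :: "'a set \<Rightarrow> 'a set set \<Rightarrow> bool" where
  "simple_graph V E \<longleftrightarrow> (\<forall>e\<in>E. e \<subseteq> V \<and> card e = 2)"

definition locally_finite_graph :: "'a set \<Rightarrow> 'a set set \<Rightarrow> bool" where
  "locally_finite_graph V E \<longleftrightarrow> (\<forall>x\<in>V. finite (nbrs V E x))"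

text \<open>By convention a connected graph has at least one vertex.\<close>
definition connected_graph :: "'a set \<Rightarrow> 'a set set \<Rightarrow> bool" where
  "connected_graph V E \<longleftrightarrow>
     V \<noteq> {} \<and> (\<forall>x\<in>V. \<forall>y\<in>V. (x, y) \<in> {(u, v). {u, v} \<in> E}\<^sup>*)"

text \<open>Functions on the vertex set are represented by functions on the whole type; at a
  vertex, the operators below only depend on the values taken on \<open>V\<close>.\<close>
definition laplacian :: "'a set \<Rightarrow> 'a set set \<Rightarrow> ('a \<Rightarrow> real) \<Rightarrow> 'a \<Rightarrow> real" where
  "laplacian V E f x = (\<Sum>y\<in>nbrs V E x. f y - f x)"

primrec Gamma_op ::
  "'a set \<Rightarrow> 'a set set \<Rightarrow> nat \<Rightarrow> ('a \<Rightarrow> real) \<Rightarrow> ('a \<Rightarrow> real) \<Rightarrow> 'a \<Rightarrow> real" where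
  "Gamma_op V E 0 f g = (\<lambda>x. f x * g x)"
| "Gamma_op V E (Suc k) f g =
     (\<lambda>x. (1 / 2) * (laplacian V E (Gamma_op V E k f g) x
            - Gamma_op V E k f (laplacian V E g) x
            - Gamma_op V E k g (laplacian V E f) x))"

text \<open>The dimension \<open>n\<close> is meant to range over \<open>0 < n \<le> \<infinity>\<close>; in
  \<^typ>\<open>ereal\<close>, a real number divided by \<open>\<infinity>\<close> is \<open>0\<close>.\<close>
definition CD :: "'a set \<Rightarrow> 'a set set \<Rightarrow> real \<Rightarrow> ereal \<Rightarrow> bool" where
  "CD V E \<kappa> n \<longleftrightarrow>
     (\<forall>f. \<forall>x\<in>V. ereal (Gamma_op V E 2 f f x)
        \<ge> ereal (\<kappa> * Gamma_op V E 1 f f x) + ereal ((laplacian V E f x)\<^sup>2) / n)"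

end

theory Submission
  imports Defs
begin

text \<open>
  Fix a vertex \<open>x\<close> and write \<open>u\<^sub>y = f y - f x\<close>. In a \<open>d\<close>-regular graph,
  \<open>4 \<Gamma>\<^sub>2(f,f)(x) = S(f) - 2 d (\<Sum>y. u\<^sub>y\<^sup>2) + 2 (\<Delta>f(x))\<^sup>2\<close>, where \<open>S(f)\<close> is the sum of
  \<open>(f z - 2 f y + f x)\<^sup>2\<close> over the walks \<open>x, y, z\<close>. Let \<open>\<rho>\<close> be the distance to \<open>x\<close>, truncated
  at \<open>2\<close>. Evaluating the curvature condition at \<open>\<rho>\<close> gives \<open>2 \<kappa> \<le> 4 + \<tau>\<close> and the upper bound
  on \<open>1 / n\<close>. Conversely, \<open>\<rho>\<close> is orthogonal, for the bilinear form of \<open>\<Gamma>\<^sub>2 - \<kappa> \<Gamma>\<^sub>1\<close> at \<open>x\<close>, to all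
  functions whose Laplacian vanishes at \<open>x\<close>. Subtracting from \<open>f\<close> the multiple of \<open>\<rho>\<close> with
  the same Laplacian at \<open>x\<close> therefore lowers the form by exactly \<open>(\<Delta>f(x))\<^sup>2 / n\<close>, and
  \<open>CD(\<kappa>,\<infinity>)\<close> applied to the remainder yields \<open>CD(\<kappa>,n)\<close>.
\<close>

section \<open>Explicit forms of the operators and of the curvature condition\<close>

lemma Gamma_1_eq:
  "Gamma_op V E 1 f g x = (\<Sum>y\<in>nbrs V E x. (f y - f x) * (g y - g x)) / 2"
proof -
  have "laplacian V E (\<lambda>x. f x * g x) x - f x * laplacian V E g x - g x * laplacian V E f x
      = (\<Sum>y\<in>nbrs V E x. (f y - f x) * (g y - g x))"
    unfolding laplacian_def sum_distrib_left sum_subtractf[symmetric]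
    by (intro sum.cong refl) (simp add: algebra_simps)
  then show ?thesis by simp
qed

lemma Gamma_2_eq:
  "Gamma_op V E 2 f f x
     = laplacian V E (Gamma_op V E 1 f f) x / 2 - Gamma_op V E 1 f (laplacian V E f) x"
proof -
  have "Gamma_op V E 2 f f = Gamma_op V E (Suc 1) f f" by (simp add: numeral_2_eq_2)
  then show ?thesis by (simp only: Gamma_op.simps(2)) (simp add: field_simps)
qed

lemma CD_ereal_iff:
  assumes "r > 0"
  shows "CD V E \<kappa> (ereal r) \<longleftrightarrow> (\<forall>f. \<forall>x\<in>V.
    \<kappa> * Gamma_op V E 1 f f x + (laplacian V E f x)\<^sup>2 / r \<le> Gamma_op V E 2 f f x)"
  using assms unfolding CD_def by simp

lemma CD_infinity_iff:
  "CD V E \<kappa> \<infinity> \<longleftrightarrow> (\<forall>f. \<forall>x\<in>V. \<kappa> * Gamma_op V E 1 f f x \<le> Gamma_op V E 2 f f x)"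
  unfolding CD_def by simp

section \<open>Neighborhoods and walks of length two\<close>

lemma nbrs_subset: "nbrs V E x \<subseteq> V"
  by (auto simp: nbrs_def)

lemma nbrs_sym: "x \<in> V \<Longrightarrow> y \<in> nbrs V E x \<Longrightarrow> x \<in> nbrs V E y"
  by (auto simp: nbrs_def insert_commute)

lemma nbrs_irrefl: "simple_graph V E \<Longrightarrow> x \<notin> nbrs V E x"
  by (auto simp: nbrs_def simple_graph_def)

definition walk_energy :: "'a set \<Rightarrow> 'a set set \<Rightarrow> ('a \<Rightarrow> real) \<Rightarrow> 'a \<Rightarrow> real" where
  "walk_energy V E f x = (\<Sum>y\<in>nbrs V E x. \<Sum>z\<in>nbrs V E y. (f z - 2 * f y + f x)\<^sup>2)"

text \<open>On the ball of radius 2 around \<open>x\<close>, which is all that \<Gamma>_2 at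
  \<open>x\<close> sees, this is the graph distance to \<open>x\<close>.\<close>

definition cut_dist :: "'a set \<Rightarrow> 'a set set \<Rightarrow> 'a \<Rightarrow> 'a \<Rightarrow> real" where
  "cut_dist V E x y = (if y = x then 0 else if y \<in> nbrs V E x then 1 else 2)"

text \<open>Of the two multiples of \<open>d\<close>, one comes from the \<open>d\<close> copies of
  \<Gamma>_1 at \<open>x\<close> that the Laplacian subtracts, the other from completing the square
  along each walk.\<close>

lemma Gamma_2_regular:
  assumes reg: "\<forall>x\<in>V. card (nbrs V E x) = d" and x: "x \<in> V"
  shows "4 * Gamma_op V E 2 f f x = walk_energy V E f x
     - 2 * real d * (\<Sum>y\<in>nbrs V E x. (f y - f x)\<^sup>2) + 2 * (laplacian V E f x)\<^sup>2"
proof -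
  let ?N = "nbrs V E"
  let ?L = "laplacian V E f"
  let ?D = "\<Sum>y\<in>?N x. (f y - f x)\<^sup>2"
  have card: "real (card (?N y)) = real d" if "y \<in> insert x (?N x)" for y
    using reg x that nbrs_subset[of V E x] by auto
  have "4 * Gamma_op V E 2 f f x
      = (\<Sum>y\<in>?N x. (\<Sum>z\<in>?N y. (f z - f y)\<^sup>2) - ?D)
        - 2 * (\<Sum>y\<in>?N x. (f y - f x) * (?L y - ?L x))"
    unfolding Gamma_2_eq Gamma_1_eq laplacian_def[of V E "Gamma_op _ _ _ _ _"]
    by (simp add: Gamma_1_eq[simplified] power2_eq_square diff_divide_distrib[symmetric]
        sum_divide_distrib[symmetric])
  also have "(\<Sum>y\<in>?N x. (\<Sum>z\<in>?N y. (f z - f y)\<^sup>2) - ?D)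
      = (\<Sum>y\<in>?N x. \<Sum>z\<in>?N y. (f z - f y)\<^sup>2) - real d * ?D"
    by (simp add: sum_subtractf card)
  also have "(\<Sum>y\<in>?N x. (f y - f x) * (?L y - ?L x))
      = (\<Sum>y\<in>?N x. \<Sum>z\<in>?N y. (f y - f x) * (f z - f y)) - (?L x)\<^sup>2"
  proof -
    have "(\<Sum>y\<in>?N x. (f y - f x) * (?L y - ?L x))
        = (\<Sum>y\<in>?N x. (f y - f x) * ?L y) - (\<Sum>y\<in>?N x. f y - f x) * ?L x"
      unfolding sum_distrib_right sum_subtractf[symmetric]
      by (intro sum.cong refl) (rule right_diff_distrib)
    then show ?thesis
      by (simp add: laplacian_def sum_distrib_left power2_eq_square)
  qed
  finally have G: "4 * Gamma_op V E 2 f f x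
      = (\<Sum>y\<in>?N x. (\<Sum>z\<in>?N y. (f z - f y)\<^sup>2) - 2 * (\<Sum>z\<in>?N y. (f y - f x) * (f z - f y)))
        - real d * ?D + 2 * (?L x)\<^sup>2"
    by (simp add: sum_subtractf sum_distrib_left[symmetric])
  \<comment> \<open>Completing the square: \<open>p^2 - 2 * p * q = (p - q)^2 - q^2\<close> with
    \<open>p = f z - f y\<close> and \<open>q = f y - f x\<close>.\<close>
  have "(\<Sum>z\<in>?N y. (f z - f y)\<^sup>2) - 2 * (\<Sum>z\<in>?N y. (f y - f x) * (f z - f y))
      = (\<Sum>z\<in>?N y. (f z - 2 * f y + f x)\<^sup>2) - real d * (f y - f x)\<^sup>2" if y: "y \<in> ?N x" for y
  proof -
    have "real d * (f y - f x)\<^sup>2 = (\<Sum>z\<in>?N y. (f y - f x)\<^sup>2)"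
      using card y by simp
    then show ?thesis
      unfolding sum_distrib_left
      by (simp only: sum_subtractf[symmetric])
        (intro sum.cong refl, simp add: power2_eq_square algebra_simps)
  qed
  then have "(\<Sum>y\<in>?N x. (\<Sum>z\<in>?N y. (f z - f y)\<^sup>2) - 2 * (\<Sum>z\<in>?N y. (f y - f x) * (f z - f y)))
      = walk_energy V E f x - real d * ?D"
    unfolding walk_energy_def sum_distrib_left[of "real d"] sum_subtractf[symmetric]
    by (intro sum.cong refl) auto
  with G show ?thesis by simp
qed

section \<open>Edge-regular graphs and the truncated distance at a vertex\<close>

locale edge_regular_graph =
  fixes V :: "'a set" and E :: "'a set set" and d \<tau> :: nat
  assumes simple: "simple_graph V E"
    and finite: "locally_finite_graph V E"
    and degree_pos: "d > 0"
    and regular: "\<forall>x\<in>V. card (nbrs V E x) = d"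
    and common: "\<forall>x\<in>V. \<forall>y\<in>V. {x, y} \<in> E \<longrightarrow> card (nbrs V E x \<inter> nbrs V E y) = \<tau>"
begin

context
  fixes x
  assumes x: "x \<in> V"
begin

abbreviation "N \<equiv> nbrs V E"
abbreviation "\<rho> \<equiv> cut_dist V E x"

lemma card_N: "card (N x) = d"
  using regular x by blast

lemma finite_N: "y \<in> V \<Longrightarrow> finite (N y)"
  using finite by (simp add: locally_finite_graph_def)

lemma card_common:
  assumes "y \<in> N x"
  shows "card (N y \<inter> N x) = \<tau>"
proof -
  have "y \<in> V" "{x, y} \<in> E" using assms by (auto simp: nbrs_def)
  then have "card (N x \<inter> N y) = \<tau>" using common x by blast
  then show ?thesis by (simp add: Int_commute)
qed

text \<open>For \<open>y\<close> adjacent to \<open>x\<close>, the second difference is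
  \<open>\<rho> z - 2\<close>: it is -2 if the walk returns to \<open>x\<close>, -1 if it closes up
  to a triangle, and 0 otherwise.\<close>

lemma sum_cut_dist_walk:
  fixes h :: "'a \<Rightarrow> real"
  assumes y: "y \<in> N x"
  shows "(\<Sum>z\<in>N y. h z * (\<rho> z - 2 * \<rho> y + \<rho> x)) = - 2 * h x - (\<Sum>z\<in>N y \<inter> N x. h z)"
proof -
  have yV: "y \<in> V" using y nbrs_subset by fast
  have "y \<noteq> x" using y nbrs_irrefl[OF simple] by auto
  then have \<rho>: "h z * (\<rho> z - 2 * \<rho> y + \<rho> x)
      = (if z = x then - 2 * h z else 0) - (if z \<in> N x then h z else 0)" for z
    using y nbrs_irrefl[OF simple] by (auto simp: cut_dist_def)
  show ?thesis
    unfolding \<rho> sum_subtractf using nbrs_sym[OF x y] finite_N[OF yV]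
    by (simp add: sum.If_cases sum.inter_restrict[symmetric] Int_def)
qed

text \<open>Double counting: each \<open>z\<close> in \<open>N x\<close> occurs once for every
  common neighbor of \<open>x\<close> and \<open>z\<close>.\<close>

lemma sum_common:
  fixes u :: "'a \<Rightarrow> real"
  shows "(\<Sum>y\<in>N x. \<Sum>z\<in>N y \<inter> N x. u z) = real \<tau> * (\<Sum>y\<in>N x. u y)"
proof -
  have "(\<Sum>y\<in>N x. \<Sum>z\<in>N y \<inter> N x. u z) = (\<Sum>y\<in>N x. \<Sum>z | z \<in> N x \<and> z \<in> N y. u z)"
    by (intro sum.cong refl) auto
  also have "\<dots> = (\<Sum>z\<in>N x. \<Sum>y | y \<in> N x \<and> z \<in> N y. u z)"
    using finite_N[OF x] by (rule sum.swap_restrict[OF _ finite_N[OF x]])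
  also have "\<dots> = (\<Sum>z\<in>N x. real \<tau> * u z)"
  proof (intro sum.cong refl)
    fix z assume z: "z \<in> N x"
    have "{y. y \<in> N x \<and> z \<in> N y} = N z \<inter> N x"
      using nbrs_sym[of _ V] z nbrs_subset by fast
    then show "(\<Sum>y | y \<in> N x \<and> z \<in> N y. u z) = real \<tau> * u z"
      using card_common[OF z] by simp
  qed
  finally show ?thesis by (simp add: sum_distrib_left)
qed

text \<open>This is the orthogonality for the walk energy: pairing with \<open>\<rho>\<close> sees
  \<open>f\<close> only through its Laplacian. With \<open>u\<close> the increment of
  \<open>f\<close> from \<open>x\<close>, returning walks give \<open>4 * u y\<close> and triangles
  give \<open>2 * \<tau> * u y\<close> minus the sum of \<open>u z\<close>; by double counting the
  latter removes one \<open>\<tau>\<close>.\<close>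

lemma walk_energy_cross:
  "(\<Sum>y\<in>N x. \<Sum>z\<in>N y. (f z - 2 * f y + f x) * (\<rho> z - 2 * \<rho> y + \<rho> x))
     = (4 + real \<tau>) * laplacian V E f x"
proof -
  let ?u = "\<lambda>y. f y - f x"
  have "(\<Sum>y\<in>N x. \<Sum>z\<in>N y. (f z - 2 * f y + f x) * (\<rho> z - 2 * \<rho> y + \<rho> x))
      = (\<Sum>y\<in>N x. (4 + 2 * real \<tau>) * ?u y - (\<Sum>z\<in>N y \<inter> N x. ?u z))"
  proof (intro sum.cong refl)
    fix y assume y: "y \<in> N x"
    have "(\<Sum>z\<in>N y \<inter> N x. f z - 2 * f y + f x) = (\<Sum>z\<in>N y \<inter> N x. ?u z - 2 * ?u y)"
      by (intro sum.cong refl) simp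
    also have "\<dots> = (\<Sum>z\<in>N y \<inter> N x. ?u z) - 2 * real \<tau> * ?u y"
      unfolding sum_subtractf[of ?u] using card_common[OF y] by simp
    finally show "(\<Sum>z\<in>N y. (f z - 2 * f y + f x) * (\<rho> z - 2 * \<rho> y + \<rho> x))
        = (4 + 2 * real \<tau>) * ?u y - (\<Sum>z\<in>N y \<inter> N x. ?u z)"
      unfolding sum_cut_dist_walk[OF y, of "\<lambda>z. f z - 2 * f y + f x"]
      by (simp add: algebra_simps)
  qed
  also have "\<dots> = (4 + 2 * real \<tau>) * (\<Sum>y\<in>N x. ?u y) - real \<tau> * (\<Sum>y\<in>N x. ?u y)"
    by (simp only: sum_subtractf[of "\<lambda>y. _ * ?u y"] sum_common sum_distrib_left)
  finally show ?thesis by (simp add: laplacian_def algebra_simps)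
qed

lemma cut_dist_nbr: "y \<in> N x \<Longrightarrow> \<rho> y - \<rho> x = 1"
  using nbrs_irrefl[OF simple] by (auto simp: cut_dist_def)

lemma laplacian_cut_dist: "laplacian V E \<rho> x = real d"
  by (simp add: laplacian_def cut_dist_nbr card_N)

lemma walk_energy_cut_dist: "walk_energy V E \<rho> x = (4 + real \<tau>) * real d"
  using walk_energy_cross[of \<rho>] laplacian_cut_dist
  by (simp add: walk_energy_def power2_eq_square)

lemma Gamma_2_cut_dist: "4 * Gamma_op V E 2 \<rho> \<rho> x = (4 + real \<tau>) * real d"
  \<comment> \<open>All increments of \<open>\<rho>\<close> at \<open>x\<close> are 1, so
    \<open>- 2 * d * d\<close> and \<open>2 * d^2\<close> cancel and only the walk energy is
    left.\<close>
  unfolding Gamma_2_regular[OF regular x] walk_energy_cut_dist laplacian_cut_dist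
  by (simp add: cut_dist_nbr card_N power2_eq_square)

lemma Gamma_1_cut_dist: "Gamma_op V E 1 \<rho> \<rho> x = real d / 2"
  unfolding Gamma_1_eq by (simp add: cut_dist_nbr card_N)

text \<open>A Pythagorean identity: the last summand is the value
  \<open>d * (4 + \<tau> - 2 * \<kappa>) / 4\<close> of the form at \<open>\<rho>\<close>, times the
  square of the coefficient of \<open>\<rho>\<close>.\<close>

lemma Gamma_2_minus_Gamma_1_decomposition:
  assumes g: "g = (\<lambda>y. f y - laplacian V E f x / real d * \<rho> y)"
  shows "Gamma_op V E 2 f f x - \<kappa> * Gamma_op V E 1 f f x
     = Gamma_op V E 2 g g x - \<kappa> * Gamma_op V E 1 g g x
       + (4 + real \<tau> - 2 * \<kappa>) / (4 * real d) * (laplacian V E f x)\<^sup>2"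
proof -
  define L c where "L = laplacian V E f x" and "c = L / real d"
  have gc: "g = (\<lambda>y. f y - c * \<rho> y)" by (simp add: g c_def L_def)
  have L: "(\<Sum>y\<in>N x. f y - f x) = L" by (simp add: L_def laplacian_def)
  have cd: "c * real d = L" using degree_pos by (simp add: c_def)
  have diff: "g y - g x = (f y - f x) - c" if "y \<in> N x" for y
    using cut_dist_nbr[OF that] unfolding gc by (auto simp: algebra_simps)
  have lap: "laplacian V E g x = 0"
    unfolding laplacian_def by (simp add: diff sum_subtractf[of _ "\<lambda>_. c"] L card_N cd mult.commute)
  have "(\<Sum>y\<in>N x. (g y - g x)\<^sup>2) = (\<Sum>y\<in>N x. (f y - f x)\<^sup>2 - 2 * c * (f y - f x) + c\<^sup>2)"
    by (intro sum.cong refl) (simp add: diff power2_diff)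
  also have "\<dots> = (\<Sum>y\<in>N x. (f y - f x)\<^sup>2) - 2 * c * L + real d * c\<^sup>2"
    by (simp only: sum.distrib sum_subtractf[of _ "\<lambda>y. _ * (f y - f x)"]
        sum_distrib_left[symmetric] L) (simp add: card_N)
  \<comment> \<open>Since \<open>c * d = L\<close>, the quadratic term \<open>d * c^2\<close>
    cancels half of the cross term; the same happens for the walk energy below.\<close>
  finally have sq: "(\<Sum>y\<in>N x. (g y - g x)\<^sup>2) = (\<Sum>y\<in>N x. (f y - f x)\<^sup>2) - c * L"
    by (simp add: cd[symmetric] power2_eq_square algebra_simps)
  have "walk_energy V E g x = (\<Sum>y\<in>N x. \<Sum>z\<in>N y. (f z - 2 * f y + f x)\<^sup>2
      - 2 * c * ((f z - 2 * f y + f x) * (\<rho> z - 2 * \<rho> y + \<rho> x))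
      + c\<^sup>2 * (\<rho> z - 2 * \<rho> y + \<rho> x)\<^sup>2)"
    unfolding walk_energy_def gc
    by (intro sum.cong refl) (simp add: power2_eq_square algebra_simps)
  also have "\<dots> = walk_energy V E f x - 2 * c * ((4 + real \<tau>) * L) + c\<^sup>2 * ((4 + real \<tau>) * real d)"
    unfolding walk_energy_cut_dist[symmetric] L_def walk_energy_cross[symmetric]
    unfolding walk_energy_def sum_distrib_left
    unfolding sum_subtractf[symmetric] sum.distrib[symmetric] ..
  finally have W: "walk_energy V E g x = walk_energy V E f x - (4 + real \<tau>) * c * L"
    by (simp add: cd[symmetric] power2_eq_square algebra_simps)
  have G1: "Gamma_op V E 1 h h x = (\<Sum>y\<in>N x. (h y - h x)\<^sup>2) / 2" for h
    unfolding Gamma_1_eq by (simp add: power2_eq_square)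
  \<comment> \<open>The term \<open>2 * L^2\<close> is absent for \<open>g\<close>, whose Laplacian
    vanishes at \<open>x\<close>; this is balanced by \<open>2 * d * (c * L)\<close>, which equals
    \<open>2 * L^2\<close>.\<close>
  have "4 * (Gamma_op V E 2 g g x - \<kappa> * Gamma_op V E 1 g g x)
      = 4 * (Gamma_op V E 2 f f x - \<kappa> * Gamma_op V E 1 f f x) - (4 + real \<tau> - 2 * \<kappa>) * (c * L)"
    unfolding right_diff_distrib[of 4] Gamma_2_regular[OF regular x] G1 lap sq W L_def[symmetric]
    by (simp add: cd[symmetric] power2_eq_square field_simps)
  moreover have "(4 + real \<tau> - 2 * \<kappa>) * (c * L)
      = 4 * ((4 + real \<tau> - 2 * \<kappa>) / (4 * real d) * L\<^sup>2)"
    by (simp add: c_def power2_eq_square)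
  moreover have "p = q + r" if "4 * q = 4 * p - t" "t = 4 * r" for p q r t :: real
    using that by simp
  ultimately show ?thesis unfolding L_def by blast
qed

end

end

section \<open>The optimal dimension\<close>

theorem theorem2:
  fixes V :: "'a set" and E :: "'a set set" and \<kappa> :: real and d \<tau> :: nat
  assumes "simple_graph V E"
    and "locally_finite_graph V E"
    and "connected_graph V E"
    and "d > 0"
    and "CD V E \<kappa> \<infinity>"
    and "\<forall>x\<in>V. card (nbrs V E x) = d"
    and "\<forall>x\<in>V. \<forall>y\<in>V. {x, y} \<in> E \<longrightarrow> card (nbrs V E x \<inter> nbrs V E y) = \<tau>"
  shows "let n = (if 2 * \<kappa> = 4 + real \<tau> then \<infinity>
                  else ereal (4 * real d / (4 + real \<tau> - 2 * \<kappa>)))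
         in 2 * \<kappa> \<le> 4 + real \<tau>
            \<and> 0 < n \<and> CD V E \<kappa> n
            \<and> (\<forall>n'. 0 < n' \<and> n' < n \<longrightarrow> \<not> CD V E \<kappa> n')"
proof -
  interpret edge_regular_graph V E d \<tau>
    using assms by unfold_locales
  obtain x where x: "x \<in> V" using assms(3) by (auto simp: connected_graph_def)
  define a where "a = 4 + real \<tau> - 2 * \<kappa>"
  \<comment> \<open>Division by zero yields 0, so the value at \<open>a = 0\<close> has to be set to
    infinity separately.\<close>
  define n where "n = (if a = 0 then \<infinity> else ereal (4 * real d / a))"
  note G = Gamma_2_cut_dist[OF x] Gamma_1_cut_dist[OF x] laplacian_cut_dist[OF x]
  have inf: "\<kappa> * Gamma_op V E 1 f f y \<le> Gamma_op V E 2 f f y" if "y \<in> V" for f y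
    using assms(5) that unfolding CD_infinity_iff by blast
  \<comment> \<open>At the truncated distance, four times \<Gamma>_2 - \<kappa> \<Gamma>_1 equals
    \<open>a * d\<close>.\<close>
  have "a * real d \<ge> 0"
    using inf[OF x, of "cut_dist V E x"] G unfolding a_def by (simp add: algebra_simps)
  then have a: "a \<ge> 0" using degree_pos by (simp add: zero_le_mult_iff)
  have n_pos: "0 < n" using a degree_pos by (auto simp: n_def)
  have CD_n: "CD V E \<kappa> n"
  proof (cases "a = 0")
    case True
    then show ?thesis using assms(5) by (simp add: n_def)
  next
    case False
    have "\<kappa> * Gamma_op V E 1 f f y + (laplacian V E f y)\<^sup>2 / (4 * real d / a)
        \<le> Gamma_op V E 2 f f y" if y: "y \<in> V" for f y
    proof -
      have "(laplacian V E f y)\<^sup>2 / (4 * real d / a) = a / (4 * real d) * (laplacian V E f y)\<^sup>2"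
        by simp
      then show ?thesis
        using Gamma_2_minus_Gamma_1_decomposition[OF y refl, of f \<kappa>]
          inf[OF y, of "\<lambda>z. f z - laplacian V E f y / real d * cut_dist V E y z"]
        unfolding a_def[symmetric] by linarith
    qed
    then show ?thesis
      using False n_pos by (simp add: n_def CD_ereal_iff)
  qed
  have "\<not> CD V E \<kappa> n'" if n': "0 < n'" "n' < n" for n'
  proof
    assume CD: "CD V E \<kappa> n'"
    obtain r where r: "n' = ereal r" "r > 0" using n' by (cases n') auto
    \<comment> \<open>The truncated distance is extremal: testing the condition on it gives
      \<open>4 * d \<le> a * r\<close>, the reverse of \<open>r < n\<close>.\<close>
    have "\<kappa> * (real d / 2) + (real d)\<^sup>2 / r \<le> Gamma_op V E 2 (cut_dist V E x) (cut_dist V E x) x"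
      using CD x G(2,3) unfolding r(1) CD_ereal_iff[OF r(2)] by metis
    then have "4 * (real d)\<^sup>2 / r \<le> a * real d"
      using G(1) unfolding a_def by (simp add: algebra_simps)
    then have "4 * real d \<le> a * r"
      using r(2) degree_pos by (simp add: field_simps power2_eq_square)
    \<comment> \<open>For \<open>a = 0\<close> this reads \<open>0 < 4 * d\<close>, which excludes
      every finite dimension; for \<open>a > 0\<close> it is \<open>r < n\<close>.\<close>
    moreover have "a * r < 4 * real d"
      using n'(2) a degree_pos unfolding r(1) n_def by (auto simp: field_simps split: if_splits)
    ultimately show False by simp
  qed
  moreover have "n = (if 2 * \<kappa> = 4 + real \<tau> then \<infinity>
      else ereal (4 * real d / (4 + real \<tau> - 2 * \<kappa>)))"
    by (auto simp: n_def a_def)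
  ultimately show ?thesis
    using a n_pos CD_n unfolding Let_def a_def by simp
qed

end
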